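(* The SVD-based IT-1.5 CKF (Algorithm 1b) is algebraically equivalent to the conventional IT-1.5 CKF (Algorithm 1a), both algorithms being written out in the context. Explicitly, in exact real arithmetic: let both algorithms be given the same data $f,h,G,\bar x_0,\Pi_0,(R_k)_{k=1}^K,\Delta,M$ and the same measurements $z_1,\dots,z_K$. Take any run of Algorithm 1b. Then there is a run of Algorithm 1a in which, at each step where Algorithm 1a performs an SVD of a covariance matrix, the chosen SVD factors are the factors of the corresponding covariance carried by Algorithm 1b at that point (in particular, these factors are legitimate SVD factors of that matrix). For these runs, for all $k=1,\dots,K$ and $m=0,\dots,M$: (i) the estimates $\hat x^{(m)}_{k-1|k-1}$, $\hat x_{k|k-1}$, $\hat z_{k|k-1}$, $\hat x_{k|k}$, the cross-covariances $P_{xz,k}$ and the gains $\mathbb K_k$ computed by the two algorithms coincide; (ii) the covariance matrices computed by Algorithm 1a are represented by the SVD factors computed by Algorithm 1b: $$P^{(m)}_{k-1|k-1}=Q^{(m)}_{P_{k-1|k-1}}D^{(m)}_{P_{k-1|k-1}}\bigl[Q^{(m)}_{P_{k-1|k-1}}\bigr]^{\top},\qquad P_{k|k-1}=Q_{P_{k|k-1}}D_{P_{k|k-1}}Q_{P_{k|k-1}}^{\top},$$ $$R_{e,k}=Q_{R_{e,k}}D_{R_{e,k}}Q_{R_{e,k}}^{\top},\qquad P_{k|k}=Q_{P_{k|k}}D_{P_{k|k}}Q_{P_{k|k}}^{\top},$$ where the matrices $Q_{\cdot}$ are orthogonal and the matrices $D_{\cdot}$ are diagonal with nonnegative entries.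
   Context: **Model.** The continuous-discrete stochastic system is $dx(t)=f(t,x(t))\,dt+\tilde G\,d\beta(t)$, $t>0$, and $z_k=h(k,x(t_k))+v_k$, $k=1,2,\dots$, with $x(t)\in\mathbb R^n$, $z_k\in\mathbb R^m$ (this $m$ is the measurement dimension; elsewhere $m$ is a loop index), $f:\mathbb R\times\mathbb R^n\to\mathbb R^n$ (smooth enough for the derivatives below to exist), $h:\mathbb R\times\mathbb R^n\to\mathbb R^m$, $\tilde G\in\mathbb R^{n\times n}$ constant. $\beta$ is an $n$-dimensional Brownian motion whose increment has covariance $Q\,dt>0$; $v_k$ is zero-mean white Gaussian noise with covariance $R_k>0$; $x(t_0)$ is Gaussian with mean $\bar x_0$ and covariance $\Pi_0>0$; the noises and $x(t_0)$ are independent. Put $G=\tilde G S_Q$, where $Q=S_QS_Q^\top$. The sampling period $\Delta=t_k-t_{k-1}$ is constant; $M\ge 1$ is an integer, $\delta=\Delta/M$, $t_{k-1}^{(m)}=t_{k-1}+m\delta$. **IT-1.5 discretization.** $f_d(t,x)=x+\delta f(t,x)+\tfrac12\delta^2\,\mathbb L_0f(t,x)$, where $$\mathbb L_0=\frac{\partial}{\partial t}+\sum_{i=1}^n f_i\frac{\partial}{\partial x_i}+\frac12\sum_{j,p,r=1}^n G_{pj}G_{rj}\frac{\partial^2}{\partial x_p\partial x_r},\qquad \mathbb L_j=\sum_{i=1}^n G_{ij}\frac{\partial}{\partial x_i},\ j=1,\dots,n,$$ and $\mathbb Lf$ is the $n\times n$ matrix with $(i,j)$ entry $\mathbb L_jf_i$.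 Write $\mathbb Lf^{(m)}_{k-1}=\mathbb Lf(t^{(m)}_{k-1},\hat x^{(m)}_{k-1|k-1})$. **Notation.** $e_i$ is the $i$-th unit vector of $\mathbb R^n$; $\xi_i=\sqrt n\,e_i$, $\xi_{n+i}=-\sqrt n\,e_i$ ($i=1,\dots,n$); $\mathbf 1_{2n}$ is the column of $2n$ ones; $\otimes$ is the Kronecker product. An SVD of a symmetric positive semidefinite matrix $P$ is a factorization $P=Q_PD_PQ_P^\top$ with $Q_P$ orthogonal and $D_P$ diagonal with nonnegative, nonincreasing entries; $D_P^{1/2}$ is the entrywise square root of the diagonal. $R_k=Q_{R_k}D_{R_k}Q_{R_k}^\top$ is an SVD of $R_k$. For a real $p\times q$ matrix $A$ with $p\le q$, $[W,S]\leftarrow \mathrm{svd}(A,\mathrm{econ})$ means: take a singular value decomposition $A=W[S\ \ 0]V^\top$ with $W\in\mathbb R^{p\times p}$, $V\in\mathbb R^{q\times q}$ orthogonal and $S\in\mathbb R^{p\times p}$ diagonal with nonnegative, nonincreasing entries, and return $W$ and $S$. SVD factors need not be unique; a run of an algorithm involves a choice of them. **Algorithm 1a (conventional IT-1.5 CKF).** Initialization: $\hat x_{0|0}=\bar x_0$, $P_{0|0}=\Pi_0$. For $k=1,\dots,K$: *Time update.* Set $\hat x^{(0)}_{k-1|k-1}=\hat x_{k-1|k-1}$, $P^{(0)}_{k-1|k-1}=P_{k-1|k-1}$. For $m=0,\dots,M-1$: - take an SVD $P^{(m)}_{k-1|k-1}=Q^{(m)}_{P_{k-1|k-1}}D^{(m)}_{P_{k-1|k-1}}[Q^{(m)}_{P_{k-1|k-1}}]^\top$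 and set $S^{(m)}_{P_{k-1|k-1}}=Q^{(m)}_{P_{k-1|k-1}}[D^{(m)}_{P_{k-1|k-1}}]^{1/2}$; - for $i=1,\dots,2n$ set $\mathcal X^{(m)}_{i,k-1|k-1}=S^{(m)}_{P_{k-1|k-1}}\xi_i+\hat x^{(m)}_{k-1|k-1}$ and $\mathcal X^{(m+1)}_{i,k-1|k-1}=f_d(t^{(m)}_{k-1},\mathcal X^{(m)}_{i,k-1|k-1})$; - $\mathcal X^{(m+1)}_{k-1|k-1}=[\mathcal X^{(m+1)}_{1,k-1|k-1},\dots,\mathcal X^{(m+1)}_{2n,k-1|k-1}]$, $\hat x^{(m+1)}_{k-1|k-1}=\frac1{2n}\mathcal X^{(m+1)}_{k-1|k-1}\mathbf 1_{2n}$, $\mathbb X^{(m+1)}_{k-1|k-1}=\frac1{\sqrt{2n}}(\mathcal X^{(m+1)}_{k-1|k-1}-\mathbf 1_{2n}^\top\otimes\hat x^{(m+1)}_{k-1|k-1})$; - $P^{(m+1)}_{k-1|k-1}=\mathbb X^{(m+1)}_{k-1|k-1}[\mathbb X^{(m+1)}_{k-1|k-1}]^\top+\frac{\delta^2}2\bigl[G(\mathbb Lf^{(m)}_{k-1})^\top+\mathbb Lf^{(m)}_{k-1}G^\top\bigr]+\delta GG^\top+\frac{\delta^3}3\mathbb Lf^{(m)}_{k-1}(\mathbb Lf^{(m)}_{k-1})^\top$. Set $\hat x_{k|k-1}=\hat x^{(M)}_{k-1|k-1}$, $P_{k|k-1}=P^{(M)}_{k-1|k-1}$. *Measurement update.*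 Take an SVD $P_{k|k-1}=Q_{P_{k|k-1}}D_{P_{k|k-1}}Q_{P_{k|k-1}}^\top$, set $S_{P_{k|k-1}}=Q_{P_{k|k-1}}D^{1/2}_{P_{k|k-1}}$. For $i=1,\dots,2n$: $\mathcal X_{i,k|k-1}=S_{P_{k|k-1}}\xi_i+\hat x_{k|k-1}$, $\mathcal Z_{i,k|k-1}=h(k,\mathcal X_{i,k|k-1})$. Collect $\mathcal X_{k|k-1}=[\mathcal X_{1,k|k-1},\dots,\mathcal X_{2n,k|k-1}]$, $\mathcal Z_{k|k-1}=[\mathcal Z_{1,k|k-1},\dots,\mathcal Z_{2n,k|k-1}]$; $\hat z_{k|k-1}=\frac1{2n}\mathcal Z_{k|k-1}\mathbf 1_{2n}$; $\mathbb X_{k|k-1}=\frac1{\sqrt{2n}}(\mathcal X_{k|k-1}-\mathbf 1_{2n}^\top\otimes\hat x_{k|k-1})$; $\mathbb Z_{k|k-1}=\frac1{\sqrt{2n}}(\mathcal Z_{k|k-1}-\mathbf 1_{2n}^\top\otimes\hat z_{k|k-1})$. Then $R_{e,k}=\mathbb Z_{k|k-1}\mathbb Z_{k|k-1}^\top+R_k$, $P_{xz,k}=\mathbb X_{k|k-1}\mathbb Z_{k|k-1}^\top$, $\mathbb K_k=P_{xz,k}R_{e,k}^{-1}$, $\hat x_{k|k}=\hat x_{k|k-1}+\mathbb K_k(z_k-\hat z_{k|k-1})$, $P_{k|k}=P_{k|k-1}-\mathbb K_kR_{e,k}\mathbb K_k^\top$. **Algorithm 1b (SVD-based IT-1.5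 CKF).** Initialization: take an SVD $\Pi_0=Q_{\Pi_0}D_{\Pi_0}Q_{\Pi_0}^\top$; set $\hat x_{0|0}=\bar x_0$, $Q_{P_{0|0}}=Q_{\Pi_0}$, $D^{1/2}_{P_{0|0}}=D^{1/2}_{\Pi_0}$. For $k=1,\dots,K$: *Time update.* Set $\hat x^{(0)}_{k-1|k-1}=\hat x_{k-1|k-1}$, $Q^{(0)}_{P_{k-1|k-1}}=Q_{P_{k-1|k-1}}$, $D^{(0),1/2}_{P_{k-1|k-1}}=D^{1/2}_{P_{k-1|k-1}}$. For $m=0,\dots,M-1$: - set $S^{(m)}_{P_{k-1|k-1}}=Q^{(m)}_{P_{k-1|k-1}}D^{(m),1/2}_{P_{k-1|k-1}}$; - compute $\mathcal X^{(m)}_{i,k-1|k-1}$, $\mathcal X^{(m+1)}_{i,k-1|k-1}$, $\mathcal X^{(m+1)}_{k-1|k-1}$, $\hat x^{(m+1)}_{k-1|k-1}$, $\mathbb X^{(m+1)}_{k-1|k-1}$ from $S^{(m)}_{P_{k-1|k-1}}$ and $\hat x^{(m)}_{k-1|k-1}$ by the same formulas as in Algorithm 1a; - form $T=\bigl[\mathbb X^{(m+1)}_{k-1|k-1},\ \sqrt\delta\,(G+\frac\delta2\mathbb Lf^{(m)}_{k-1}),\ \sqrt{\frac{\delta^3}{12}}\,\mathbb Lf^{(m)}_{k-1}\bigr]$ and $[Q^{(m+1)}_{P_{k-1|k-1}},D^{(m+1),1/2}_{P_{k-1|k-1}}]\leftarrow\mathrm{svd}(T,\mathrm{econ})$. Set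 $\hat x_{k|k-1}=\hat x^{(M)}_{k-1|k-1}$, $Q_{P_{k|k-1}}=Q^{(M)}_{P_{k-1|k-1}}$, $D^{1/2}_{P_{k|k-1}}=D^{(M),1/2}_{P_{k-1|k-1}}$. *Measurement update.* Set $S_{P_{k|k-1}}=Q_{P_{k|k-1}}D^{1/2}_{P_{k|k-1}}$; compute $\mathcal X_{i,k|k-1},\mathcal Z_{i,k|k-1},\mathcal X_{k|k-1},\mathcal Z_{k|k-1},\hat z_{k|k-1},\mathbb X_{k|k-1},\mathbb Z_{k|k-1}$ by the same formulas as in Algorithm 1a. Form $A=[\mathbb Z_{k|k-1},\ Q_{R_k}D_{R_k}^{1/2}]$ and $[Q_{R_{e,k}},D^{1/2}_{R_{e,k}}]\leftarrow\mathrm{svd}(A,\mathrm{econ})$. Compute $P_{xz,k}=\mathbb X_{k|k-1}\mathbb Z_{k|k-1}^\top$, $\mathbb K_k=P_{xz,k}Q_{R_{e,k}}D_{R_{e,k}}^{-1}Q_{R_{e,k}}^\top$, $\hat x_{k|k}=\hat x_{k|k-1}+\mathbb K_k(z_k-\hat z_{k|k-1})$. Form $B=[\mathbb X_{k|k-1}-\mathbb K_k\mathbb Z_{k|k-1},\ \mathbb K_kQ_{R_k}D_{R_k}^{1/2}]$ and $[Q_{P_{k|k}},D^{1/2}_{P_{k|k}}]\leftarrow\mathrm{svd}(B,\mathrm{econ})$. Here every $D_{\cdot}$ (or $D^{(m)}_{\cdot}$) in Algorithm 1b denotes the square of the corresponding diagonal matrix $D^{1/2}_{\cdot}$ (or $D^{(m),1/2}_{\cdot}$).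 *)

theory Defs
  imports
    "HOL-Analysis.Derivative"
    "Jordan_Normal_Form.Gauss_Jordan_Elimination"
begin

text \<open>
  Vectors and matrices are the dimension-carrying ones of \<open>Jordan_Normal_Form\<close>, so that the
  block matrices with $2n$, $4n$ and $2n+m$ columns and the leading $p$ columns of an economy
  SVD can be written literally. Indices start at 0.
\<close>

unbundle no vec_syntax
unbundle no inner_syntax

section \<open>Matrices and singular value decompositions\<close>

text \<open>The constant \<open>orthogonal_mat\<close> of \<open>Jordan_Normal_Form\<close> does not normalize the columns.\<close>

definition orth_mat :: "nat \<Rightarrow> real mat \<Rightarrow> bool" where
  "orth_mat n Q \<longleftrightarrow> Q \<in> carrier_mat n n \<and>
     transpose_mat Q * Q = 1\<^sub>m n \<and> Q * transpose_mat Q = 1\<^sub>m n"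

definition nonneg_diag :: "nat \<Rightarrow> real mat \<Rightarrow> bool" where
  "nonneg_diag n D \<longleftrightarrow> D \<in> carrier_mat n n \<and> diagonal_mat D \<and> (\<forall>i<n. 0 \<le> D $$ (i,i))"

definition nonincreasing_diag :: "nat \<Rightarrow> real mat \<Rightarrow> bool" where
  "nonincreasing_diag n D \<longleftrightarrow> (\<forall>i j. i \<le> j \<and> j < n \<longrightarrow> D $$ (j,j) \<le> D $$ (i,i))"

definition factored_by :: "nat \<Rightarrow> real mat \<Rightarrow> real mat \<Rightarrow> real mat \<Rightarrow> bool" where
  "factored_by n P Q D \<longleftrightarrow>
     orth_mat n Q \<and> nonneg_diag n D \<and> P = Q * D * transpose_mat Q"

text \<open>Symmetry and positive semidefiniteness of \<open>P\<close> follow from the factorization.\<close>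

definition sym_svd :: "nat \<Rightarrow> real mat \<Rightarrow> real mat \<Rightarrow> real mat \<Rightarrow> bool" where
  "sym_svd n P Q D \<longleftrightarrow> factored_by n P Q D \<and> nonincreasing_diag n D"

text \<open>Only applied to diagonal matrices with nonnegative entries (and \<open>sqrt 0 = 0\<close>).\<close>

definition diag_sqrt :: "real mat \<Rightarrow> real mat" where
  "diag_sqrt D = map_mat sqrt D"

definition append_cols :: "real mat \<Rightarrow> real mat \<Rightarrow> real mat" (infixr \<open>@\<^sub>c\<close> 65) where
  "A @\<^sub>c B = four_block_mat A B (0\<^sub>m 0 (dim_col A)) (0\<^sub>m 0 (dim_col B))"

text \<open>\<open>W\<close> and \<open>S\<close> are a possible outcome of $\mathrm{svd}(A,\mathrm{econ})$, $A$ being $p\times q$.\<close>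

definition econ_svd :: "nat \<Rightarrow> nat \<Rightarrow> real mat \<Rightarrow> real mat \<Rightarrow> real mat \<Rightarrow> bool" where
  "econ_svd p q A W S \<longleftrightarrow>
     p \<le> q \<and> A \<in> carrier_mat p q \<and>
     orth_mat p W \<and> nonneg_diag p S \<and> nonincreasing_diag p S \<and>
     (\<exists>V. orth_mat q V \<and> A = W * (S @\<^sub>c 0\<^sub>m p (q - p)) * transpose_mat V)"

definition sym_pos_def :: "nat \<Rightarrow> real mat \<Rightarrow> bool" where
  "sym_pos_def n A \<longleftrightarrow> A \<in> carrier_mat n n \<and> transpose_mat A = A \<and>
     (\<forall>v\<in>carrier_vec n. v \<noteq> 0\<^sub>v n \<longrightarrow> 0 < v \<bullet> (A *\<^sub>v v))"

text \<open>The inverse of an invertible matrix; the value at a singular matrix is unspecified.\<close>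

definition inv_mat :: "real mat \<Rightarrow> real mat" where
  "inv_mat A = the (mat_inverse A)"

section \<open>The problem data\<close>

record ckf_data =
  state_dim :: nat                                  (* n *)
  meas_dim :: nat                                   (* m *)
  drift :: "real \<Rightarrow> real vec \<Rightarrow> real vec"            (* f *)
  obs :: "real \<Rightarrow> real vec \<Rightarrow> real vec"              (* h *)
  diffusion :: "real mat"                           (* G-tilde *)
  bm_cov :: "real mat"                              (* Q *)
  bm_root :: "real mat"                             (* S_Q *)
  init_mean :: "real vec"                           (* x-bar_0 *)
  init_cov :: "real mat"                            (* Pi_0 *)
  noise_cov :: "nat \<Rightarrow> real mat"                    (* R_k *)
  init_time :: real                                 (* t_0 *)
  period :: real                                    (* Delta *)
  substeps :: nat                                   (* M *)
  horizon :: nat                                    (* K *)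
  meas :: "nat \<Rightarrow> real vec"                         (* z_k *)

definition noise_mat :: "ckf_data \<Rightarrow> real mat" where  (* G *)
  "noise_mat d = diffusion d * bm_root d"

definition step :: "ckf_data \<Rightarrow> real" where  (* delta *)
  "step d = period d / real (substeps d)"

text \<open>The time $t_{k-1}^{(m)}$, for $k \ge 1$.\<close>

definition grid_time :: "ckf_data \<Rightarrow> nat \<Rightarrow> nat \<Rightarrow> real" where
  "grid_time d k m = init_time d + real (k - 1) * period d + real m * step d"

section \<open>The IT-1.5 discretization\<close>

definition partial_t :: "(real \<Rightarrow> real vec \<Rightarrow> real) \<Rightarrow> real \<Rightarrow> real vec \<Rightarrow> real" where
  "partial_t \<phi> t x = deriv (\<lambda>s. \<phi> s x) t"

definition partial_x :: "nat \<Rightarrow> (real \<Rightarrow> real vec \<Rightarrow> real) \<Rightarrow> real \<Rightarrow> real vec \<Rightarrow> real" where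
  "partial_x i \<phi> t x = deriv (\<lambda>s. \<phi> t (x |\<^sub>v i \<mapsto> s)) (x $ i)"

definition partial_x_exists ::
    "nat \<Rightarrow> (real \<Rightarrow> real vec \<Rightarrow> real) \<Rightarrow> real \<Rightarrow> real vec \<Rightarrow> bool" where
  "partial_x_exists i \<phi> t x \<longleftrightarrow> (\<lambda>s. \<phi> t (x |\<^sub>v i \<mapsto> s)) field_differentiable at (x $ i)"

definition smooth_enough :: "nat \<Rightarrow> (real \<Rightarrow> real vec \<Rightarrow> real vec) \<Rightarrow> bool" where
  "smooth_enough n f \<longleftrightarrow> (\<forall>i<n. \<forall>t. \<forall>x\<in>carrier_vec n.
     (\<lambda>s. f s x $ i) field_differentiable at t \<and>
     (\<forall>r<n. partial_x_exists r (\<lambda>t x. f t x $ i) t x \<and>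
        (\<forall>p<n. partial_x_exists p (partial_x r (\<lambda>t x. f t x $ i)) t x)))"

definition op_L0 ::
    "ckf_data \<Rightarrow> (real \<Rightarrow> real vec \<Rightarrow> real) \<Rightarrow> real \<Rightarrow> real vec \<Rightarrow> real" where
  "op_L0 d \<phi> t x = (let n = state_dim d; G = noise_mat d in
     partial_t \<phi> t x
     + (\<Sum>i<n. drift d t x $ i * partial_x i \<phi> t x)
     + 1/2 * (\<Sum>j<n. \<Sum>p<n. \<Sum>r<n.
         G $$ (p,j) * G $$ (r,j) * partial_x p (partial_x r \<phi>) t x))"

definition op_L ::
    "ckf_data \<Rightarrow> nat \<Rightarrow> (real \<Rightarrow> real vec \<Rightarrow> real) \<Rightarrow> real \<Rightarrow> real vec \<Rightarrow> real" where
  "op_L d j \<phi> t x = (\<Sum>i<state_dim d. noise_mat d $$ (i,j) * partial_x i \<phi> t x)"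

definition L0f :: "ckf_data \<Rightarrow> real \<Rightarrow> real vec \<Rightarrow> real vec" where
  "L0f d t x = Matrix.vec (state_dim d) (\<lambda>i. op_L0 d (\<lambda>t x. drift d t x $ i) t x)"

definition Lf :: "ckf_data \<Rightarrow> real \<Rightarrow> real vec \<Rightarrow> real mat" where
  "Lf d t x = Matrix.mat (state_dim d) (state_dim d)
     (\<lambda>(i,j). op_L d j (\<lambda>t x. drift d t x $ i) t x)"

definition f_d :: "ckf_data \<Rightarrow> real \<Rightarrow> real vec \<Rightarrow> real vec" where
  "f_d d t x = x + step d \<cdot>\<^sub>v drift d t x + (1/2 * (step d)\<^sup>2) \<cdot>\<^sub>v L0f d t x"

definition valid_data :: "ckf_data \<Rightarrow> bool" where
  "valid_data d \<longleftrightarrow> (let n = state_dim d; m = meas_dim d in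
     1 \<le> n \<and> 1 \<le> m \<and>
     (\<forall>t. \<forall>x\<in>carrier_vec n. drift d t x \<in> carrier_vec n) \<and>
     smooth_enough n (drift d) \<and>
     (\<forall>t. \<forall>x\<in>carrier_vec n. obs d t x \<in> carrier_vec m) \<and>
     diffusion d \<in> carrier_mat n n \<and>
     sym_pos_def n (bm_cov d) \<and>
     bm_root d \<in> carrier_mat n n \<and> bm_cov d = bm_root d * transpose_mat (bm_root d) \<and>
     init_mean d \<in> carrier_vec n \<and>
     sym_pos_def n (init_cov d) \<and>
     (\<forall>k\<in>{1..horizon d}. sym_pos_def m (noise_cov d k) \<and> meas d k \<in> carrier_vec m) \<and>
     0 < period d \<and> 1 \<le> substeps d)"

section \<open>Cubature formulas common to both algorithms\<close>

definition \<xi> :: "nat \<Rightarrow> nat \<Rightarrow> real vec" where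
  "\<xi> n i = (if i < n then sqrt (real n) \<cdot>\<^sub>v unit_vec n i
             else (- sqrt (real n)) \<cdot>\<^sub>v unit_vec n (i - n))"

definition node :: "nat \<Rightarrow> real mat \<Rightarrow> real vec \<Rightarrow> nat \<Rightarrow> real vec" where
  "node n S x i = S *\<^sub>v \<xi> n i + x"

text \<open>The matrices of nodes, of nodes propagated by $f_d(t,\cdot)$ and of nodes mapped
  by $h(k,\cdot)$.\<close>

definition node_mat :: "ckf_data \<Rightarrow> real mat \<Rightarrow> real vec \<Rightarrow> real mat" where
  "node_mat d S x = (let n = state_dim d in
     mat_of_cols n (map (node n S x) [0..<2*n]))"

definition prop_mat :: "ckf_data \<Rightarrow> real \<Rightarrow> real mat \<Rightarrow> real vec \<Rightarrow> real mat" where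
  "prop_mat d t S x = (let n = state_dim d in
     mat_of_cols n (map (\<lambda>i. f_d d t (node n S x i)) [0..<2*n]))"

definition obs_mat :: "ckf_data \<Rightarrow> nat \<Rightarrow> real mat \<Rightarrow> real vec \<Rightarrow> real mat" where
  "obs_mat d k S x = (let n = state_dim d in
     mat_of_cols (meas_dim d) (map (\<lambda>i. obs d (real k) (node n S x i)) [0..<2*n]))"

text \<open>For a matrix \<open>X\<close> with $2n$ columns.\<close>

definition col_mean :: "nat \<Rightarrow> real mat \<Rightarrow> real vec" where
  "col_mean n X = (1 / (2 * real n)) \<cdot>\<^sub>v (X *\<^sub>v Matrix.vec (2*n) (\<lambda>_. 1))"

text \<open>The subtracted matrix is the Kronecker product $\mathbf 1_{2n}^\top\otimes x$.\<close>

definition centered :: "nat \<Rightarrow> real mat \<Rightarrow> real vec \<Rightarrow> real mat" where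
  "centered n X x = (1 / sqrt (2 * real n)) \<cdot>\<^sub>m
     (X - Matrix.mat (dim_vec x) (2*n) (\<lambda>(i,j). x $ i))"

section \<open>Runs of the two algorithms\<close>

text \<open>
  A run records the values assigned to the variables. The quantities with superscript $(m)$
  and index $k-1|k-1$ of the time update in step \<open>k\<close> are stored at \<open>k\<close> and \<open>m\<close>; the filtered
  quantities with index $k|k$ are stored at \<open>k\<close>, starting with \<open>k = 0\<close>.
\<close>

record ckf_run =
  x_sub :: "nat \<Rightarrow> nat \<Rightarrow> real vec"
  x_pred :: "nat \<Rightarrow> real vec"
  z_pred :: "nat \<Rightarrow> real vec"
  P_xz :: "nat \<Rightarrow> real mat"
  gain :: "nat \<Rightarrow> real mat"
  x_filt :: "nat \<Rightarrow> real vec"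

record ckf_run_a = ckf_run +
  P_sub :: "nat \<Rightarrow> nat \<Rightarrow> real mat"
  P_pred :: "nat \<Rightarrow> real mat"
  R_e :: "nat \<Rightarrow> real mat"
  P_filt :: "nat \<Rightarrow> real mat"
  svdQ_sub :: "nat \<Rightarrow> nat \<Rightarrow> real mat"
  svdD_sub :: "nat \<Rightarrow> nat \<Rightarrow> real mat"
  svdQ_pred :: "nat \<Rightarrow> real mat"
  svdD_pred :: "nat \<Rightarrow> real mat"

text \<open>The fields with prefix \<open>H\<close> hold the matrices $D^{1/2}$ carried by the SVD-based algorithm.\<close>

record ckf_run_b = ckf_run +
  Q_sub :: "nat \<Rightarrow> nat \<Rightarrow> real mat"
  H_sub :: "nat \<Rightarrow> nat \<Rightarrow> real mat"
  Q_pred :: "nat \<Rightarrow> real mat"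
  H_pred :: "nat \<Rightarrow> real mat"
  Q_R :: "nat \<Rightarrow> real mat"
  D_R :: "nat \<Rightarrow> real mat"
  Q_Re :: "nat \<Rightarrow> real mat"
  H_Re :: "nat \<Rightarrow> real mat"
  Q_filt :: "nat \<Rightarrow> real mat"
  H_filt :: "nat \<Rightarrow> real mat"

definition D_sub :: "ckf_run_b \<Rightarrow> nat \<Rightarrow> nat \<Rightarrow> real mat" where
  "D_sub b k m = H_sub b k m * H_sub b k m"

definition D_pred :: "ckf_run_b \<Rightarrow> nat \<Rightarrow> real mat" where
  "D_pred b k = H_pred b k * H_pred b k"

definition D_Re :: "ckf_run_b \<Rightarrow> nat \<Rightarrow> real mat" where
  "D_Re b k = H_Re b k * H_Re b k"

definition D_filt :: "ckf_run_b \<Rightarrow> nat \<Rightarrow> real mat" where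
  "D_filt b k = H_filt b k * H_filt b k"

subsection \<open>The conventional IT-1.5 CKF\<close>

definition time_update_a :: "ckf_data \<Rightarrow> ckf_run_a \<Rightarrow> nat \<Rightarrow> bool" where
  "time_update_a d a k \<longleftrightarrow> (let n = state_dim d; \<delta> = step d; G = noise_mat d in
     x_sub a k 0 = x_filt a (k - 1) \<and> P_sub a k 0 = P_filt a (k - 1) \<and>
     (\<forall>m<substeps d.
        sym_svd n (P_sub a k m) (svdQ_sub a k m) (svdD_sub a k m) \<and>
        (let S = svdQ_sub a k m * diag_sqrt (svdD_sub a k m);
             t = grid_time d k m;
             L = Lf d t (x_sub a k m);
             X = prop_mat d t S (x_sub a k m);
             XX = centered n X (x_sub a k (Suc m))
         in x_sub a k (Suc m) = col_mean n X \<and>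
            P_sub a k (Suc m) =
              XX * transpose_mat XX
              + (\<delta>^2 / 2) \<cdot>\<^sub>m (G * transpose_mat L + L * transpose_mat G)
              + \<delta> \<cdot>\<^sub>m (G * transpose_mat G)
              + (\<delta>^3 / 3) \<cdot>\<^sub>m (L * transpose_mat L))) \<and>
     x_pred a k = x_sub a k (substeps d) \<and> P_pred a k = P_sub a k (substeps d))"

definition meas_update_a :: "ckf_data \<Rightarrow> ckf_run_a \<Rightarrow> nat \<Rightarrow> bool" where
  "meas_update_a d a k \<longleftrightarrow> (let n = state_dim d in
     sym_svd n (P_pred a k) (svdQ_pred a k) (svdD_pred a k) \<and>
     (let S = svdQ_pred a k * diag_sqrt (svdD_pred a k);
          Z = obs_mat d k S (x_pred a k);
          XX = centered n (node_mat d S (x_pred a k)) (x_pred a k);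
          ZZ = centered n Z (z_pred a k)
      in z_pred a k = col_mean n Z \<and>
         R_e a k = ZZ * transpose_mat ZZ + noise_cov d k \<and>
         P_xz a k = XX * transpose_mat ZZ \<and>
         invertible_mat (R_e a k) \<and>
         gain a k = P_xz a k * inv_mat (R_e a k) \<and>
         x_filt a k = x_pred a k + gain a k *\<^sub>v (meas d k - z_pred a k) \<and>
         P_filt a k = P_pred a k - gain a k * R_e a k * transpose_mat (gain a k)))"

definition run_a :: "ckf_data \<Rightarrow> ckf_run_a \<Rightarrow> bool" where
  "run_a d a \<longleftrightarrow>
     x_filt a 0 = init_mean d \<and> P_filt a 0 = init_cov d \<and>
     (\<forall>k\<in>{1..horizon d}. time_update_a d a k \<and> meas_update_a d a k)"

subsection \<open>The SVD-based IT-1.5 CKF\<close>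

definition time_update_b :: "ckf_data \<Rightarrow> ckf_run_b \<Rightarrow> nat \<Rightarrow> bool" where
  "time_update_b d b k \<longleftrightarrow> (let n = state_dim d; \<delta> = step d; G = noise_mat d in
     x_sub b k 0 = x_filt b (k - 1) \<and>
     Q_sub b k 0 = Q_filt b (k - 1) \<and> H_sub b k 0 = H_filt b (k - 1) \<and>
     (\<forall>m<substeps d.
        let S = Q_sub b k m * H_sub b k m;
            t = grid_time d k m;
            L = Lf d t (x_sub b k m);
            X = prop_mat d t S (x_sub b k m);
            XX = centered n X (x_sub b k (Suc m));
            T = XX @\<^sub>c (sqrt \<delta> \<cdot>\<^sub>m (G + (\<delta> / 2) \<cdot>\<^sub>m L)) @\<^sub>c (sqrt (\<delta>^3 / 12) \<cdot>\<^sub>m L)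
        in x_sub b k (Suc m) = col_mean n X \<and>
           econ_svd n (4*n) T (Q_sub b k (Suc m)) (H_sub b k (Suc m))) \<and>
     x_pred b k = x_sub b k (substeps d) \<and>
     Q_pred b k = Q_sub b k (substeps d) \<and> H_pred b k = H_sub b k (substeps d))"

text \<open>
  Invertibility of \<open>D_Re\<close> is not made a condition on the run: it is a consequence of
  $R_k > 0$, so that \<open>inv_mat\<close> is the inverse here.
\<close>

definition meas_update_b :: "ckf_data \<Rightarrow> ckf_run_b \<Rightarrow> nat \<Rightarrow> bool" where
  "meas_update_b d b k \<longleftrightarrow> (let n = state_dim d; m = meas_dim d in
     sym_svd m (noise_cov d k) (Q_R b k) (D_R b k) \<and>
     (let S = Q_pred b k * H_pred b k;
          Z = obs_mat d k S (x_pred b k);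
          XX = centered n (node_mat d S (x_pred b k)) (x_pred b k);
          ZZ = centered n Z (z_pred b k);
          S_R = Q_R b k * diag_sqrt (D_R b k)
      in z_pred b k = col_mean n Z \<and>
         econ_svd m (2*n + m) (ZZ @\<^sub>c S_R) (Q_Re b k) (H_Re b k) \<and>
         P_xz b k = XX * transpose_mat ZZ \<and>
         gain b k = P_xz b k * Q_Re b k * inv_mat (D_Re b k) * transpose_mat (Q_Re b k) \<and>
         x_filt b k = x_pred b k + gain b k *\<^sub>v (meas d k - z_pred b k) \<and>
         econ_svd n (2*n + m) ((XX - gain b k * ZZ) @\<^sub>c (gain b k * S_R))
           (Q_filt b k) (H_filt b k)))"

definition run_b :: "ckf_data \<Rightarrow> ckf_run_b \<Rightarrow> bool" where
  "run_b d b \<longleftrightarrow>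
     x_filt b 0 = init_mean d \<and>
     (\<exists>D. sym_svd (state_dim d) (init_cov d) (Q_filt b 0) D \<and> H_filt b 0 = diag_sqrt D) \<and>
     (\<forall>k\<in>{1..horizon d}. time_update_b d b k \<and> meas_update_b d b k)"

subsection \<open>Matching SVD choices\<close>

definition svd_choices_from :: "ckf_data \<Rightarrow> ckf_run_a \<Rightarrow> ckf_run_b \<Rightarrow> bool" where
  "svd_choices_from d a b \<longleftrightarrow> (\<forall>k\<in>{1..horizon d}.
     (\<forall>m<substeps d. svdQ_sub a k m = Q_sub b k m \<and> svdD_sub a k m = D_sub b k m) \<and>
     svdQ_pred a k = Q_pred b k \<and> svdD_pred a k = D_pred b k)"

end

theory Submission
  imports Defs "Jordan_Normal_Form.Determinant"
begin

text \<open>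
  The two filters run the same recursion; they differ only in how a covariance is represented.
  Algorithm 1a keeps the covariance $P$ and factorizes it when it needs a square root, whereas
  Algorithm 1b keeps an orthogonal $Q$ and a diagonal $H = D^{1/2}$ and never forms
  $P = Q H^2 Q^\top$. The link is that an economy SVD $A = W[S\ 0]V^\top$ of a block row $A$
  forgets $V$ but preserves the Gram matrix, $A A^\top = W S^2 W^\top$ (\<open>econ_svd_gram\<close>), and
  that the Gram matrix of a block row is the sum of those of its blocks
  (\<open>gram_append_cols\<close>). Each block row of Algorithm 1b is designed so that this sum is the
  covariance that Algorithm 1a computes:

  \<^item> in the time update, completing the square in $G$ turns the cross terms
    $\frac{\delta^2}{2}(G L^\top + L G^\top)$ into a Gram matrix (\<open>gram_time_update\<close>);
  \<^item> $[\mathbb Z,\ Q_R D_R^{1/2}]$ has Gram matrix $\mathbb Z \mathbb Z^\top + R = R_e$;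
  \<^item> $[\mathbb X - K \mathbb Z,\ K Q_R D_R^{1/2}]$ has as its Gram matrix the Joseph form of the
    filtered covariance. It equals $P - K R_e K^\top$ because the gain satisfies
    $K R_e = \mathbb X \mathbb Z^\top$ and the centred cubature nodes reproduce $P$ exactly,
    $\mathbb X \mathbb X^\top = P$ (\<open>gram_joseph\<close>, \<open>gram_centered_node_mat\<close>).

  The gains agree because $R_e \ge R > 0$ is invertible and
  $(Q D Q^\top)^{-1} = Q D^{-1} Q^\top$ for orthogonal $Q$.

  Given a run of Algorithm 1b, multiplying out all its factors therefore yields covariances that
  satisfy the equations of Algorithm 1a one by one, which gives the required run
  (\<open>recomposed_run_is_run\<close>) and, for it, claims (i) and (ii). Once its SVD factors are
  prescribed, Algorithm 1a is deterministic (\<open>run_a_deterministic\<close>), so every other run with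
  these factors agrees with the recomposed one. Matrix algebra enters only the first half, and
  induction over the time steps only the second.
\<close>

section \<open>Matrix algebra with dimension side conditions\<close>

text \<open>
  Carrier hypotheses on products contain an inner dimension that rewriting has to guess.
  Stated with \<open>dim_row\<close> and \<open>dim_col\<close>, the side conditions of the ring laws evaluate by
  simplification, and \<open>mat_expand\<close> expands any product of block expressions.
\<close>

lemma mult_assoc_dim:
  fixes A B C :: "real mat"
  assumes "dim_col A = dim_row B" "dim_col B = dim_row C"
  shows "(A * B) * C = A * (B * C)"
  using assms by (intro assoc_mult_mat) auto

lemma transpose_mult_dim:
  fixes A B :: "real mat"
  assumes "dim_col A = dim_row B"
  shows "transpose_mat (A * B) = transpose_mat B * transpose_mat A"
  using assms by (intro transpose_mult) auto

lemma mult_add_dim: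
  fixes A B C :: "real mat"
  assumes "dim_col A = dim_row B" "dim_row B = dim_row C" "dim_col B = dim_col C"
  shows "A * (B + C) = A * B + A * C"
  using assms by (intro mult_add_distrib_mat) auto

lemma add_mult_dim:
  fixes A B C :: "real mat"
  assumes "dim_col A = dim_row C" "dim_row A = dim_row B" "dim_col A = dim_col B"
  shows "(A + B) * C = A * C + B * C"
  using assms by (intro add_mult_distrib_mat) auto

lemma mult_minus_dim:
  fixes A B C :: "real mat"
  assumes "dim_col A = dim_row B" "dim_row B = dim_row C" "dim_col B = dim_col C"
  shows "A * (B - C) = A * B - A * C"
  using assms by (intro mult_minus_distrib_mat) auto

lemma minus_mult_dim:
  fixes A B C :: "real mat"
  assumes "dim_col A = dim_row C" "dim_row A = dim_row B" "dim_col A = dim_col B"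
  shows "(A - B) * C = A * C - B * C"
  using assms by (intro minus_mult_distrib_mat) auto

lemma smult_mult_dim:
  fixes A B :: "real mat"
  assumes "dim_col A = dim_row B"
  shows "(c \<cdot>\<^sub>m A) * B = c \<cdot>\<^sub>m (A * B)"
  using assms by (intro mult_smult_assoc_mat) auto

lemma mult_smult_dim:
  fixes A B :: "real mat"
  assumes "dim_col A = dim_row B"
  shows "A * (c \<cdot>\<^sub>m B) = c \<cdot>\<^sub>m (A * B)"
  using assms by (intro mult_smult_distrib) auto

lemma transpose_add_dim:
  fixes A B :: "real mat"
  assumes "dim_row A = dim_row B" "dim_col A = dim_col B"
  shows "transpose_mat (A + B) = transpose_mat A + transpose_mat B"
  using assms by (intro transpose_add) auto

lemma transpose_minus_dim:
  fixes A B :: "real mat"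
  assumes "dim_row A = dim_row B" "dim_col A = dim_col B"
  shows "transpose_mat (A - B) = transpose_mat A - transpose_mat B"
  using assms by (intro transpose_minus) auto

lemma transpose_smult_mat: "transpose_mat (c \<cdot>\<^sub>m A) = (c :: real) \<cdot>\<^sub>m transpose_mat A"
  by (intro eq_matI) auto

lemmas mat_expand = mult_assoc_dim transpose_mult_dim mult_add_dim add_mult_dim mult_minus_dim
  minus_mult_dim smult_mult_dim mult_smult_dim transpose_add_dim transpose_minus_dim
  transpose_smult_mat

section \<open>Gram matrices of block rows\<close>

lemma append_cols_dim [simp]:
  "dim_row (A @\<^sub>c B) = dim_row A" "dim_col (A @\<^sub>c B) = dim_col A + dim_col B"
  by (auto simp: append_cols_def)

lemma gram_append_cols:
  assumes "dim_row A = dim_row B"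
  shows "(A @\<^sub>c B) * transpose_mat (A @\<^sub>c B) = A * transpose_mat A + B * transpose_mat B"
proof -
  let ?p = "dim_row A"
  have T: "transpose_mat (A @\<^sub>c B)
    = four_block_mat (transpose_mat A) (0\<^sub>m (dim_col A) 0) (transpose_mat B) (0\<^sub>m (dim_col B) 0)"
    unfolding append_cols_def
    by (subst transpose_four_block_mat[of A ?p "dim_col A" B "dim_col B" _ 0])
      (auto simp: assms zero_transpose_mat)
  show ?thesis
    unfolding T unfolding append_cols_def
    by (subst mult_four_block_mat[of A ?p "dim_col A" B "dim_col B" _ 0 _ _ ?p _ 0])
      (auto simp: assms intro!: eq_matI)
qed

section \<open>Nonnegative diagonal matrices and their square roots\<close>

lemma nonneg_diag_off_diagonal:
  assumes "nonneg_diag n D" "i < n" "j < n" "i \<noteq> j"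
  shows "D $$ (i,j) = 0"
  using assms by (auto simp: nonneg_diag_def diagonal_mat_def)

lemma nonneg_diag_transpose:
  assumes "nonneg_diag n D" shows "transpose_mat D = D"
proof -
  have "D \<in> carrier_mat n n" using assms by (simp add: nonneg_diag_def)
  then show ?thesis
    using nonneg_diag_off_diagonal[OF assms] by (intro eq_matI) (auto, metis)
qed

lemma nonneg_diag_square_index:
  assumes D: "nonneg_diag n D" and ij: "i < n" "j < n"
  shows "(D * D) $$ (i,j) = (if i = j then (D $$ (i,i))\<^sup>2 else 0)"
proof -
  have c: "D \<in> carrier_mat n n" using D by (simp add: nonneg_diag_def)
  have "(D * D) $$ (i,j) = (\<Sum>k\<in>{0..<n}. D $$ (i,k) * D $$ (k,j))"
    using c ij by (simp add: scalar_prod_def)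
  also have "\<dots> = (\<Sum>k\<in>{0..<n}. if k = i then D $$ (i,i) * D $$ (i,j) else 0)"
    using ij by (intro sum.cong) (auto simp: nonneg_diag_off_diagonal[OF D, of i])
  also have "\<dots> = D $$ (i,i) * D $$ (i,j)" using ij by simp
  finally show ?thesis using nonneg_diag_off_diagonal[OF D ij] by (auto simp: power2_eq_square)
qed

lemma nonneg_diag_square: "nonneg_diag n D \<Longrightarrow> nonneg_diag n (D * D)"
  using nonneg_diag_square_index[of n D]
  by (auto simp: nonneg_diag_def diagonal_mat_def)

lemma nonincreasing_diag_square:
  assumes "nonneg_diag n D" "nonincreasing_diag n D"
  shows "nonincreasing_diag n (D * D)"
  using assms by (auto simp: nonincreasing_diag_def nonneg_diag_square_index nonneg_diag_def
      intro!: power_mono simp del: index_mult_mat)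

lemma diag_sqrt_square:
  assumes "nonneg_diag n D"
  shows "diag_sqrt (D * D) = D"
proof -
  have "D \<in> carrier_mat n n" "\<forall>i<n. 0 \<le> D $$ (i,i)" using assms by (simp_all add: nonneg_diag_def)
  then show ?thesis
    using nonneg_diag_square_index[OF assms] nonneg_diag_off_diagonal[OF assms]
    by (intro eq_matI) (auto simp: diag_sqrt_def simp del: index_mult_mat(1))
qed

lemma diag_sqrt_nonneg_diag: "nonneg_diag n D \<Longrightarrow> nonneg_diag n (diag_sqrt D)"
  by (auto simp: nonneg_diag_def diag_sqrt_def diagonal_mat_def)

lemma square_diag_sqrt:
  assumes "nonneg_diag n D"
  shows "diag_sqrt D * diag_sqrt D = D"
proof -
  have "D \<in> carrier_mat n n" "\<forall>i<n. 0 \<le> D $$ (i,i)" using assms by (simp_all add: nonneg_diag_def)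
  moreover have "dim_row (diag_sqrt D) = dim_row D" "dim_col (diag_sqrt D) = dim_col D"
    by (simp_all add: diag_sqrt_def)
  ultimately show ?thesis
    using nonneg_diag_square_index[OF diag_sqrt_nonneg_diag[OF assms]] nonneg_diag_off_diagonal[OF assms]
    by (intro eq_matI) (auto simp: diag_sqrt_def simp del: index_mult_mat(1))
qed

section \<open>Singular value factors carried in place of a covariance\<close>

text \<open>
  The invariant of Algorithm 1b: $Q$ and $H = D^{1/2}$ are the SVD factors of the covariance
  $Q H^2 Q^\top$, which is left implicit.
\<close>

definition svd_root :: "nat \<Rightarrow> real mat \<Rightarrow> real mat \<Rightarrow> bool" where
  "svd_root n Q H \<longleftrightarrow> orth_mat n Q \<and> nonneg_diag n H \<and> nonincreasing_diag n H"

lemma svd_root_carrier: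
  "svd_root n Q H \<Longrightarrow> dim_row Q = n" "svd_root n Q H \<Longrightarrow> dim_col Q = n"
  "svd_root n Q H \<Longrightarrow> dim_row H = n" "svd_root n Q H \<Longrightarrow> dim_col H = n"
  by (auto simp: svd_root_def orth_mat_def nonneg_diag_def)

lemma svd_root_diag_sqrt: "svd_root n Q H \<Longrightarrow> diag_sqrt (H * H) = H"
  using diag_sqrt_square by (auto simp: svd_root_def)

text \<open>
  The ordering of the diagonal survives squaring because its entries are nonnegative, so that
  the carried factors are admissible choices wherever the conventional filter takes an SVD.
\<close>

lemma svd_root_sym_svd:
  assumes "svd_root n Q H"
  shows "sym_svd n (Q * (H * H) * transpose_mat Q) Q (H * H)"
  using assms
  by (simp add: svd_root_def sym_svd_def factored_by_def nonneg_diag_square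
      nonincreasing_diag_square)

lemma svd_root_gram:
  assumes "svd_root n Q H"
  shows "(Q * H) * transpose_mat (Q * H) = Q * (H * H) * transpose_mat Q"
proof -
  have "transpose_mat H = H" using assms nonneg_diag_transpose by (auto simp: svd_root_def)
  then show ?thesis using svd_root_carrier[OF assms] by (simp add: mat_expand)
qed

lemma sym_svd_imp_svd_root:
  assumes "sym_svd n P Q D"
  shows "svd_root n Q (diag_sqrt D)" "P = Q * (diag_sqrt D * diag_sqrt D) * transpose_mat Q"
proof -
  have D: "nonneg_diag n D" and "orth_mat n Q" "nonincreasing_diag n D"
    "P = Q * D * transpose_mat Q"
    using assms by (auto simp: sym_svd_def factored_by_def)
  moreover have "nonincreasing_diag n (diag_sqrt D)"
    using D \<open>nonincreasing_diag n D\<close>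
    by (auto simp: nonincreasing_diag_def diag_sqrt_def nonneg_diag_def)
  ultimately show "svd_root n Q (diag_sqrt D)"
    "P = Q * (diag_sqrt D * diag_sqrt D) * transpose_mat Q"
    by (simp_all add: svd_root_def diag_sqrt_nonneg_diag square_diag_sqrt)
qed

text \<open>
  Orthogonality of $V$ removes it from $A A^\top$, and the padding zeros contribute nothing.
  This replaces every covariance of Algorithm 1a by the block row that Algorithm 1b decomposes.
\<close>

lemma econ_svd_gram:
  assumes "econ_svd p q A W S"
  shows "svd_root p W S" "A * transpose_mat A = W * (S * S) * transpose_mat W"
proof -
  obtain V where V: "orth_mat q V" and A: "A = W * (S @\<^sub>c 0\<^sub>m p (q - p)) * transpose_mat V"
    and pq: "p \<le> q"
    using assms by (auto simp: econ_svd_def)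
  show R: "svd_root p W S" using assms by (simp add: econ_svd_def svd_root_def)
  let ?S = "S @\<^sub>c 0\<^sub>m p (q - p)"
  have dV: "dim_row V = q" "dim_col V = q" and VV: "transpose_mat V * V = 1\<^sub>m q"
    using V by (auto simp: orth_mat_def)
  note d = svd_root_carrier[OF R] dV pq
  have St: "transpose_mat S = S" using R nonneg_diag_transpose by (auto simp: svd_root_def)
  have SS: "?S * transpose_mat ?S = S * S"
    using d by (subst gram_append_cols) (auto simp: St zero_transpose_mat intro!: eq_matI)
  have "A * transpose_mat A = W * (?S * ((transpose_mat V * V) * transpose_mat ?S)) * transpose_mat W"
    unfolding A using d by (simp add: mat_expand)
  also have "\<dots> = W * (?S * transpose_mat ?S) * transpose_mat W"
    unfolding VV using d by (subst left_mult_one_mat[of _ q p]) auto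
  finally show "A * transpose_mat A = W * (S * S) * transpose_mat W" unfolding SS .
qed

section \<open>Inverses of positive definite matrices\<close>

lemma inv_mat_eqI:
  assumes "A \<in> carrier_mat n n" "B \<in> carrier_mat n n" "A * B = 1\<^sub>m n" "B * A = 1\<^sub>m n"
  shows "inv_mat A = B"
proof -
  have "A \<in> Units (ring_mat TYPE(real) n ())"
    using assms by (auto simp: Units_def ring_mat_def)
  then obtain C where C: "mat_inverse A = Some C"
    using mat_inverse(1)[OF assms(1)] by fastforce
  have AC: "A * C = 1\<^sub>m n" "C \<in> carrier_mat n n" using mat_inverse(2)[OF assms(1) C] by auto
  have "C = (B * A) * C" unfolding assms(4) using AC by simp
  also have "\<dots> = B * (A * C)" using assms AC by (intro assoc_mult_mat) auto
  finally have "C = B" unfolding AC(1) using assms by simp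
  then show ?thesis by (simp add: inv_mat_def C)
qed

lemma sym_pos_def_inverse:
  assumes A: "sym_pos_def n A"
  obtains B where "B \<in> carrier_mat n n" "A * B = 1\<^sub>m n" "B * A = 1\<^sub>m n"
proof -
  have c: "A \<in> carrier_mat n n" using A by (simp add: sym_pos_def_def)
  have "det A \<noteq> 0"
  proof
    assume "det A = 0"
    then obtain v where v: "v \<in> carrier_vec n" "v \<noteq> 0\<^sub>v n" "A *\<^sub>v v = 0\<^sub>v n"
      using det_0_iff_vec_prod_zero_field[OF c] by auto
    have "0 < v \<bullet> (A *\<^sub>v v)" using A v(1,2) by (auto simp: sym_pos_def_def)
    then show False using v(1) unfolding v(3) by simp
  qed
  then have "A \<in> Units (ring_mat TYPE(real) n ())" by (rule det_non_zero_imp_unit[OF c])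
  then show thesis using that by (auto simp: Units_def ring_mat_def)
qed

lemma sym_pos_def_invertible_mat:
  assumes "sym_pos_def n A" shows "invertible_mat A"
proof -
  obtain B where "B \<in> carrier_mat n n" "A * B = 1\<^sub>m n" "B * A = 1\<^sub>m n"
    using sym_pos_def_inverse[OF assms] .
  moreover have "A \<in> carrier_mat n n" using assms by (simp add: sym_pos_def_def)
  ultimately show ?thesis by (auto simp: invertible_mat_def inverts_mat_def)
qed

text \<open>
  This identifies the two forms of the gain. Invertibility of $D$ comes for free: it is
  orthogonally similar to $A$, so that $Q^\top A^{-1} Q$ inverts it.
\<close>

lemma inv_mat_factored_by:
  assumes A: "sym_pos_def n A" and f: "factored_by n A Q D"
  shows "inv_mat A = Q * inv_mat D * transpose_mat Q" and "inv_mat D \<in> carrier_mat n n"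
proof -
  obtain B where B: "B \<in> carrier_mat n n" "A * B = 1\<^sub>m n" "B * A = 1\<^sub>m n"
    using sym_pos_def_inverse[OF A] .
  have AD: "A = Q * D * transpose_mat Q" and Q: "transpose_mat Q * Q = 1\<^sub>m n" "Q * transpose_mat Q = 1\<^sub>m n"
    and c: "dim_row Q = n" "dim_col Q = n" "dim_row D = n" "dim_col D = n"
       "dim_row A = n" "dim_col A = n" "dim_row B = n" "dim_col B = n"
    using f B A by (auto simp: factored_by_def orth_mat_def nonneg_diag_def sym_pos_def_def)
  have cancel: "transpose_mat Q * (Q * X) = X" "Q * (transpose_mat Q * X) = X"
    if "dim_row X = n" for X :: "real mat"
    using that c Q mult_assoc_dim[of "transpose_mat Q" Q X] mult_assoc_dim[of Q "transpose_mat Q" X]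
    by auto
  have cancelB: "A * (B * X) = X" "B * (A * X) = X" if "dim_row X = n" for X :: "real mat"
    using that c B mult_assoc_dim[of A B X] mult_assoc_dim[of B A X] by auto
  have D: "D = transpose_mat Q * (A * Q)"
    unfolding AD using c Q by (simp add: mult_assoc_dim cancel)
  have "inv_mat D = transpose_mat Q * (B * Q)"
    unfolding D using c B
    by (intro inv_mat_eqI[of _ n]) (auto simp: mult_assoc_dim cancel cancelB Q)
  moreover have "inv_mat A = B" using c B by (intro inv_mat_eqI[of _ n]) auto
  ultimately show "inv_mat A = Q * inv_mat D * transpose_mat Q"
    using c Q by (simp add: mult_assoc_dim cancel)
  show "inv_mat D \<in> carrier_mat n n"
    unfolding \<open>inv_mat D = _\<close> using c by (intro carrier_matI) simp_all
qed

lemma sym_pos_def_inv_mat: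
  assumes A: "sym_pos_def n A"
  shows "inv_mat A \<in> carrier_mat n n" "inv_mat A * A = 1\<^sub>m n"
proof -
  have c: "A \<in> carrier_mat n n" using A by (simp add: sym_pos_def_def)
  obtain B where "B \<in> carrier_mat n n" "A * B = 1\<^sub>m n" "B * A = 1\<^sub>m n"
    using sym_pos_def_inverse[OF A] .
  with inv_mat_eqI[OF c this] show "inv_mat A \<in> carrier_mat n n" "inv_mat A * A = 1\<^sub>m n"
    by simp_all
qed

text \<open>
  The innovation covariance $R_e$ inherits definiteness from the measurement noise, however
  degenerate the cubature nodes are, since $v^\top Z Z^\top v = \|Z^\top v\|^2 \ge 0$.
\<close>

lemma sym_pos_def_gram_add:
  assumes R: "sym_pos_def n R" and Z: "dim_row Z = n"
  shows "sym_pos_def n (Z * transpose_mat Z + R)"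
proof -
  have c: "R \<in> carrier_mat n n" "transpose_mat R = R" using R by (auto simp: sym_pos_def_def)
  have Zc: "Z \<in> carrier_mat n (dim_col Z)" and Zt: "transpose_mat Z \<in> carrier_mat (dim_col Z) n"
    and ZZ: "Z * transpose_mat Z \<in> carrier_mat n n"
    using Z by auto
  show ?thesis
    unfolding sym_pos_def_def
  proof (intro conjI ballI impI)
    show "transpose_mat (Z * transpose_mat Z + R) = Z * transpose_mat Z + R"
      using c Z by (simp add: mat_expand)
    fix v :: "real Matrix.vec" assume v: "v \<in> carrier_vec n" "v \<noteq> 0\<^sub>v n"
    let ?w = "transpose_mat Z *\<^sub>v v"
    have w: "?w \<in> carrier_vec (dim_col Z)" by (intro carrier_vecI) simp
    have "v \<bullet> (Z *\<^sub>v ?w) = ?w \<bullet> ?w"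
      by (rule transpose_vec_mult_scalar[OF Zc w v(1), symmetric])
    moreover have "0 \<le> ?w \<bullet> ?w" by (auto simp: scalar_prod_def intro!: sum_nonneg)
    moreover have "0 < v \<bullet> (R *\<^sub>v v)" using R v by (simp add: sym_pos_def_def)
    moreover have "(Z * transpose_mat Z + R) *\<^sub>v v = Z *\<^sub>v ?w + R *\<^sub>v v"
      unfolding add_mult_distrib_mat_vec[OF ZZ c(1) v(1)]
        assoc_mult_mat_vec[OF Zc Zt v(1)] ..
    moreover have "v \<bullet> (Z *\<^sub>v ?w + R *\<^sub>v v) = v \<bullet> (Z *\<^sub>v ?w) + v \<bullet> (R *\<^sub>v v)"
      by (rule scalar_prod_add_distrib[OF v(1) mult_mat_vec_carrier[OF Zc w]
            mult_mat_vec_carrier[OF c(1) v(1)]])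
    ultimately show "0 < v \<bullet> ((Z * transpose_mat Z + R) *\<^sub>v v)" by simp
  qed (use c Z in auto)
qed

section \<open>The block rows of the SVD-based filter\<close>

text \<open>
  Completing the square: $\delta (G + \frac\delta2 L)(G + \frac\delta2 L)^\top$ accounts for
  both cross terms and for $\frac{\delta^3}{4} L L^\top$, and the last block supplies the missing
  $\frac{\delta^3}{3} - \frac{\delta^3}{4} = \frac{\delta^3}{12}$.
\<close>

lemma gram_time_update:
  fixes X G L :: "real mat"
  assumes \<delta>: "0 \<le> \<delta>" and X: "dim_row X = n"
    and G: "G \<in> carrier_mat n n" and L: "L \<in> carrier_mat n n"
  defines "T \<equiv> X @\<^sub>c (sqrt \<delta> \<cdot>\<^sub>m (G + (\<delta> / 2) \<cdot>\<^sub>m L)) @\<^sub>c (sqrt (\<delta>^3 / 12) \<cdot>\<^sub>m L)"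
  shows "T * transpose_mat T =
    X * transpose_mat X
    + (\<delta>^2 / 2) \<cdot>\<^sub>m (G * transpose_mat L + L * transpose_mat G)
    + \<delta> \<cdot>\<^sub>m (G * transpose_mat G)
    + (\<delta>^3 / 3) \<cdot>\<^sub>m (L * transpose_mat L)"
proof -
  have d: "dim_row G = n" "dim_col G = n" "dim_row L = n" "dim_col L = n" using G L by auto
  have s: "sqrt \<delta> * (sqrt \<delta> * x) = \<delta> * x" "sqrt (\<delta>^3/12) * (sqrt (\<delta>^3/12) * x) = \<delta>^3/12 * x" for x
    using \<delta> by (simp_all flip: mult.assoc)
  show ?thesis
    unfolding T_def using d X
    by (simp add: gram_append_cols mat_expand, intro eq_matI)
      (simp_all add: s del: index_mult_mat(1) real_sqrt_divide real_sqrt_power,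
        simp add: s field_simps power2_eq_square power3_eq_cube del: index_mult_mat(1))
qed

text \<open>
  Expanding the left-hand side gives
  $X X^\top - X Z^\top K^\top - K Z X^\top + K R K^\top$. The gain equation, used directly and
  transposed, turns each of the two cross terms into $K R K^\top$.
\<close>

lemma gram_joseph:
  fixes X Z S K :: "real mat"
  assumes d: "dim_row X = n" "dim_row Z = p" "dim_col X = dim_col Z" "dim_row S = p"
     "dim_row K = n" "dim_col K = p"
    and KR: "K * R = X * transpose_mat Z" and R: "R = Z * transpose_mat Z + S * transpose_mat S"
  shows "((X - K * Z) @\<^sub>c (K * S)) * transpose_mat ((X - K * Z) @\<^sub>c (K * S))
     = X * transpose_mat X - K * R * transpose_mat K"
proof -
  have R': "dim_row R = p" "dim_col R = p" "transpose_mat R = R"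
    using d by (simp_all add: R mat_expand)
  have XZK: "X * (transpose_mat Z * transpose_mat K) = K * (R * transpose_mat K)"
    using KR d R' by (metis mult_assoc_dim index_transpose_mat(2,3))
  have "transpose_mat (K * R) = transpose_mat (X * transpose_mat Z)" unfolding KR ..
  then have "R * transpose_mat K = Z * transpose_mat X"
    using d R' by (simp add: mat_expand)
  then have KZX: "K * (Z * transpose_mat X) = K * (R * transpose_mat K)" by simp
  have KRK: "K * (R * transpose_mat K)
    = K * (Z * (transpose_mat Z * transpose_mat K)) + K * (S * (transpose_mat S * transpose_mat K))"
    using d by (simp add: R mat_expand)
  show ?thesis
    using d R'
    by (simp add: gram_append_cols mat_expand XZK KZX, simp add: KRK, intro eq_matI)
      (simp_all del: index_mult_mat(1))
qed

text \<open>
  The nodes are $x \pm \sqrt n\, S e_i$. Centring removes $x$, and the normalization by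
  $\sqrt{2n}$ leaves the factor $1/\sqrt2$, for which the two copies of $S$ compensate in the
  Gram matrix.
\<close>

lemma centered_node_mat:
  assumes n: "n = state_dim d" "1 \<le> n" and S: "S \<in> carrier_mat n n" and x: "x \<in> carrier_vec n"
  shows "centered n (node_mat d S x) x = ((1 / sqrt 2) \<cdot>\<^sub>m S) @\<^sub>c ((- 1 / sqrt 2) \<cdot>\<^sub>m S)"
proof -
  have sc: "row S i \<bullet> (c \<cdot>\<^sub>v unit_vec n j) = c * S $$ (i,j)" if "i < n" "j < n" for i j c
    using that S by (simp add: scalar_prod_smult_distrib[of _ n])
  show ?thesis
    using S x n(2)
    by (intro eq_matI) (auto simp: centered_def node_mat_def append_cols_def node_def \<xi>_def
        n(1)[symmetric] mat_of_cols_index sc real_sqrt_mult)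
qed

lemma gram_centered_node_mat:
  assumes "n = state_dim d" "1 \<le> n" and S: "S \<in> carrier_mat n n" and "x \<in> carrier_vec n"
  shows "centered n (node_mat d S x) x * transpose_mat (centered n (node_mat d S x) x)
    = S * transpose_mat S"
  unfolding centered_node_mat[OF assms]
  using S
  by (simp add: gram_append_cols mat_expand, intro eq_matI)
    (simp_all del: index_mult_mat(1) add: field_simps)


section \<open>The run of the conventional filter obtained by multiplying out the factors\<close>

lemma col_mean_dim [simp]: "dim_vec (col_mean n X) = dim_row X"
  by (simp add: col_mean_def)

lemma centered_dim [simp]:
  "dim_row (centered n X x) = dim_vec x" "dim_col (centered n X x) = 2 * n"
  by (simp_all add: centered_def)

lemma prop_mat_dim [simp]: "dim_row (prop_mat d t S x) = state_dim d"
  by (simp add: prop_mat_def Let_def)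

lemma obs_mat_dim [simp]: "dim_row (obs_mat d k S x) = meas_dim d"
  by (simp add: obs_mat_def Let_def)

text \<open>
  Each covariance is read off the factors carried at the same point instead of being defined by
  the recursion of Algorithm 1a, so that the recursion can be verified one equation at a time.
\<close>

definition recomposed_run :: "ckf_run_b \<Rightarrow> ckf_run_a" where
  "recomposed_run b = \<lparr>
     x_sub = x_sub b, x_pred = x_pred b, z_pred = z_pred b,
     P_xz = P_xz b, gain = gain b, x_filt = x_filt b,
     P_sub = \<lambda>k m. Q_sub b k m * D_sub b k m * transpose_mat (Q_sub b k m),
     P_pred = \<lambda>k. Q_pred b k * D_pred b k * transpose_mat (Q_pred b k),
     R_e = \<lambda>k. Q_Re b k * D_Re b k * transpose_mat (Q_Re b k),
     P_filt = \<lambda>k. Q_filt b k * D_filt b k * transpose_mat (Q_filt b k),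
     svdQ_sub = Q_sub b, svdD_sub = D_sub b, svdQ_pred = Q_pred b, svdD_pred = D_pred b\<rparr>"

text \<open>
  The initial factors of a time update are those of the previous filtering step; all later
  ones are produced by an economy SVD.
\<close>

lemma time_update_b_svd_root:
  assumes b: "time_update_b d b k"
    and filt: "svd_root (state_dim d) (Q_filt b (k - 1)) (H_filt b (k - 1))"
    and m: "m \<le> substeps d"
  shows "svd_root (state_dim d) (Q_sub b k m) (H_sub b k m)"
proof (cases m)
  case 0
  then show ?thesis using b filt by (simp add: time_update_b_def Let_def)
next
  case (Suc m')
  then show ?thesis using b m econ_svd_gram(1)
    unfolding time_update_b_def Let_def by (meson Suc_le_lessD)
qed

lemma time_update_b_imp_a:
  assumes d: "valid_data d" and b: "time_update_b d b k"
    and filt: "svd_root (state_dim d) (Q_filt b (k - 1)) (H_filt b (k - 1))"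
  shows "time_update_a d (recomposed_run b) k"
proof -
  let ?n = "state_dim d" and ?\<delta> = "step d" and ?G = "noise_mat d"
  have G: "?G \<in> carrier_mat ?n ?n" and \<delta>: "0 \<le> ?\<delta>"
    using d by (auto simp: valid_data_def Let_def noise_mat_def step_def)
  have sub: "sym_svd ?n (P_sub (recomposed_run b) k m) (Q_sub b k m) (D_sub b k m) \<and>
      (let S = Q_sub b k m * diag_sqrt (D_sub b k m);
           t = grid_time d k m;
           L = Lf d t (x_sub b k m);
           X = prop_mat d t S (x_sub b k m);
           XX = centered ?n X (x_sub b k (Suc m))
       in x_sub b k (Suc m) = col_mean ?n X \<and>
          P_sub (recomposed_run b) k (Suc m) =
            XX * transpose_mat XX
            + (?\<delta>^2 / 2) \<cdot>\<^sub>m (?G * transpose_mat L + L * transpose_mat ?G)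
            + ?\<delta> \<cdot>\<^sub>m (?G * transpose_mat ?G)
            + (?\<delta>^3 / 3) \<cdot>\<^sub>m (L * transpose_mat L))"
    if m: "m < substeps d" for m
  proof -
    have root: "svd_root ?n (Q_sub b k m) (H_sub b k m)"
      using time_update_b_svd_root[OF b filt] m by simp
    then have H: "diag_sqrt (D_sub b k m) = H_sub b k m"
      by (simp add: D_sub_def svd_root_diag_sqrt)
    define t where "t = grid_time d k m"
    define L where "L = Lf d t (x_sub b k m)"
    define X where "X = prop_mat d t (Q_sub b k m * H_sub b k m) (x_sub b k m)"
    define XX where "XX = centered ?n X (x_sub b k (Suc m))"
    let ?T = "XX @\<^sub>c (sqrt ?\<delta> \<cdot>\<^sub>m (?G + (?\<delta> / 2) \<cdot>\<^sub>m L)) @\<^sub>c (sqrt (?\<delta>^3 / 12) \<cdot>\<^sub>m L)"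
    have x: "x_sub b k (Suc m) = col_mean ?n X"
      and svd: "econ_svd ?n (4 * ?n) ?T (Q_sub b k (Suc m)) (H_sub b k (Suc m))"
      using b m unfolding time_update_b_def Let_def XX_def X_def L_def t_def by blast+
    have "dim_row XX = ?n" by (simp add: XX_def x X_def)
    moreover have "L \<in> carrier_mat ?n ?n" by (simp add: L_def Lf_def)
    ultimately have "?T * transpose_mat ?T =
            XX * transpose_mat XX
            + (?\<delta>^2 / 2) \<cdot>\<^sub>m (?G * transpose_mat L + L * transpose_mat ?G)
            + ?\<delta> \<cdot>\<^sub>m (?G * transpose_mat ?G)
            + (?\<delta>^3 / 3) \<cdot>\<^sub>m (L * transpose_mat L)"
      by (rule gram_time_update[OF \<delta> _ G])
    moreover have "P_sub (recomposed_run b) k (Suc m) = ?T * transpose_mat ?T"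
      unfolding econ_svd_gram(2)[OF svd] by (simp add: recomposed_run_def D_sub_def)
    moreover have "sym_svd ?n (P_sub (recomposed_run b) k m) (Q_sub b k m) (D_sub b k m)"
      using svd_root_sym_svd[OF root] by (simp add: recomposed_run_def D_sub_def)
    ultimately show ?thesis
      unfolding H Let_def using x unfolding XX_def X_def L_def t_def by metis
  qed
  have r: "x_sub (recomposed_run b) = x_sub b" "x_filt (recomposed_run b) = x_filt b"
    "x_pred (recomposed_run b) = x_pred b"
    "svdQ_sub (recomposed_run b) = Q_sub b" "svdD_sub (recomposed_run b) = D_sub b"
    by (simp_all add: recomposed_run_def)
  have ends: "x_sub b k 0 = x_filt b (k - 1)"
    "P_sub (recomposed_run b) k 0 = P_filt (recomposed_run b) (k - 1)"
    "x_pred b k = x_sub b k (substeps d)"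
    "P_pred (recomposed_run b) k = P_sub (recomposed_run b) k (substeps d)"
    using b by (simp_all add: time_update_b_def Let_def recomposed_run_def D_sub_def D_filt_def
        D_pred_def)
  show ?thesis
    unfolding time_update_a_def Let_def r using ends sub unfolding Let_def by blast
qed

lemma time_update_b_pred:
  assumes d: "valid_data d" and b: "time_update_b d b k"
    and filt: "svd_root (state_dim d) (Q_filt b (k - 1)) (H_filt b (k - 1))"
  shows "svd_root (state_dim d) (Q_pred b k) (H_pred b k)" "x_pred b k \<in> carrier_vec (state_dim d)"
proof -
  show "svd_root (state_dim d) (Q_pred b k) (H_pred b k)"
    using time_update_b_svd_root[OF b filt, of "substeps d"] b
    by (simp add: time_update_b_def Let_def)
  \<comment> \<open>As there is at least one substep, the prediction is a mean of columns and thus has the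
    right dimension.\<close>
  obtain m where m: "substeps d = Suc m"
    using d by (cases "substeps d") (auto simp: valid_data_def Let_def)
  then have "x_pred b k = col_mean (state_dim d)
      (prop_mat d (grid_time d k m) (Q_sub b k m * H_sub b k m) (x_sub b k m))"
    using b by (simp add: time_update_b_def Let_def)
  then show "x_pred b k \<in> carrier_vec (state_dim d)" by (intro carrier_vecI) simp
qed

lemma meas_update_b_imp_a:
  assumes d: "valid_data d" and b: "meas_update_b d b k" and k: "k \<in> {1..horizon d}"
    and pred: "svd_root (state_dim d) (Q_pred b k) (H_pred b k)"
    and x: "x_pred b k \<in> carrier_vec (state_dim d)"
  shows "meas_update_a d (recomposed_run b) k"
    and "svd_root (meas_dim d) (Q_Re b k) (H_Re b k)"
    and "svd_root (state_dim d) (Q_filt b k) (H_filt b k)"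
proof -
  let ?n = "state_dim d" and ?p = "meas_dim d"
  have n: "1 \<le> ?n" and R: "sym_pos_def ?p (noise_cov d k)"
    using d k by (auto simp: valid_data_def Let_def)
  define S where "S = Q_pred b k * H_pred b k"
  define Z where "Z = obs_mat d k S (x_pred b k)"
  define XX where "XX = centered ?n (node_mat d S (x_pred b k)) (x_pred b k)"
  define ZZ where "ZZ = centered ?n Z (z_pred b k)"
  define SR where "SR = Q_R b k * diag_sqrt (D_R b k)"
  define K where "K = gain b k"
  define Re where "Re = Q_Re b k * D_Re b k * transpose_mat (Q_Re b k)"
  have svdR: "sym_svd ?p (noise_cov d k) (Q_R b k) (D_R b k)"
    and z: "z_pred b k = col_mean ?n Z"
    and svdRe: "econ_svd ?p (2 * ?n + ?p) (ZZ @\<^sub>c SR) (Q_Re b k) (H_Re b k)"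
    and Pxz: "P_xz b k = XX * transpose_mat ZZ"
    and gain: "K = P_xz b k * Q_Re b k * inv_mat (D_Re b k) * transpose_mat (Q_Re b k)"
    and xf: "x_filt b k = x_pred b k + K *\<^sub>v (meas d k - z_pred b k)"
    and svdP: "econ_svd ?n (2 * ?n + ?p) ((XX - K * ZZ) @\<^sub>c (K * SR)) (Q_filt b k) (H_filt b k)"
    using b unfolding meas_update_b_def Let_def S_def Z_def XX_def ZZ_def SR_def K_def by blast+
  show rootRe: "svd_root ?p (Q_Re b k) (H_Re b k)" by (rule econ_svd_gram(1)[OF svdRe])
  show "svd_root ?n (Q_filt b k) (H_filt b k)" by (rule econ_svd_gram(1)[OF svdP])
  note rootR = sym_svd_imp_svd_root(1)[OF svdR]
  have SR: "SR * transpose_mat SR = noise_cov d k"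
    unfolding SR_def svd_root_gram[OF rootR] sym_svd_imp_svd_root(2)[OF svdR, symmetric] ..
  have dims: "dim_row XX = ?n" "dim_col XX = 2 * ?n" "dim_row ZZ = ?p" "dim_col ZZ = 2 * ?n"
    "dim_row SR = ?p"
    using x svd_root_carrier[OF rootR] by (simp_all add: XX_def ZZ_def z Z_def SR_def)
  have Re: "Re = ZZ * transpose_mat ZZ + SR * transpose_mat SR"
    unfolding Re_def D_Re_def econ_svd_gram(2)[OF svdRe, symmetric]
    by (rule gram_append_cols) (simp add: dims)
  have pd: "sym_pos_def ?p Re"
    unfolding Re SR by (rule sym_pos_def_gram_add[OF R dims(3)])
  have Re_dim: "Re \<in> carrier_mat ?p ?p" using pd by (simp add: sym_pos_def_def)
  have fac: "factored_by ?p Re (Q_Re b k) (D_Re b k)"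
    using svd_root_sym_svd[OF rootRe] by (simp add: sym_svd_def Re_def D_Re_def)
  have inv: "inv_mat Re = Q_Re b k * inv_mat (D_Re b k) * transpose_mat (Q_Re b k)"
    by (rule inv_mat_factored_by(1)[OF pd fac])
  have invRe: "inv_mat Re \<in> carrier_mat ?p ?p" "inv_mat Re * Re = 1\<^sub>m ?p"
    using sym_pos_def_inv_mat[OF pd] by auto
  have gain_a: "K = P_xz b k * inv_mat Re"
    unfolding gain inv Pxz
    using dims svd_root_carrier[OF rootRe] inv_mat_factored_by(2)[OF pd fac]
    by (simp add: mult_assoc_dim)
  have KRe: "K * Re = XX * transpose_mat ZZ"
    unfolding gain_a Pxz using dims invRe Re_dim by (simp add: mult_assoc_dim)
  have P: "P_pred (recomposed_run b) k = XX * transpose_mat XX"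
  proof -
    have "S \<in> carrier_mat ?n ?n"
      using svd_root_carrier[OF pred] by (intro carrier_matI) (simp_all add: S_def)
    from gram_centered_node_mat[OF refl n this x] show ?thesis
      by (simp add: XX_def S_def svd_root_gram[OF pred] recomposed_run_def D_pred_def)
  qed
  have Pf: "P_filt (recomposed_run b) k = P_pred (recomposed_run b) k - K * Re * transpose_mat K"
  proof -
    have "K \<in> carrier_mat ?n ?p"
      using dims invRe by (intro carrier_matI) (simp_all add: gain_a Pxz)
    then have "P_pred (recomposed_run b) k - K * Re * transpose_mat K
        = ((XX - K * ZZ) @\<^sub>c (K * SR)) * transpose_mat ((XX - K * ZZ) @\<^sub>c (K * SR))"
      unfolding P using dims by (intro gram_joseph[OF _ _ _ _ _ _ KRe Re, symmetric]) auto
    then show ?thesis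
      unfolding econ_svd_gram(2)[OF svdP] by (simp add: recomposed_run_def D_filt_def)
  qed
  \<comment> \<open>The square root that Algorithm 1a takes of the prescribed \<open>D_pred\<close> returns the carried factor,
    so both algorithms use the same nodes.\<close>
  have H: "diag_sqrt (D_pred b k) = H_pred b k"
    by (simp add: D_pred_def svd_root_diag_sqrt[OF pred])
  have svd_pred: "sym_svd ?n (P_pred (recomposed_run b) k) (Q_pred b k) (D_pred b k)"
    using svd_root_sym_svd[OF pred] by (simp add: recomposed_run_def D_pred_def)
  have r: "x_pred (recomposed_run b) = x_pred b" "z_pred (recomposed_run b) = z_pred b"
    "P_xz (recomposed_run b) = P_xz b" "gain (recomposed_run b) = gain b"
    "x_filt (recomposed_run b) = x_filt b"
    "svdQ_pred (recomposed_run b) = Q_pred b" "svdD_pred (recomposed_run b) = D_pred b"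
    "R_e (recomposed_run b) k = Re"
    by (simp_all add: recomposed_run_def Re_def)
  show "meas_update_a d (recomposed_run b) k"
    unfolding meas_update_a_def Let_def r H
    using svd_pred z Re Pxz gain_a xf Pf sym_pos_def_invertible_mat[OF pd] unfolding SR
    unfolding S_def[symmetric] Z_def[symmetric] XX_def[symmetric] ZZ_def[symmetric] K_def[symmetric]
    by blast
qed

lemma run_b_svd_root:
  assumes b: "run_b d b" and k: "k \<le> horizon d"
  shows "svd_root (state_dim d) (Q_filt b k) (H_filt b k)"
proof (cases "k = 0")
  case True
  then show ?thesis using b sym_svd_imp_svd_root(1) by (auto simp: run_b_def)
next
  case False
  then have "meas_update_b d b k" using b k by (simp add: run_b_def)
  then show ?thesis
    unfolding meas_update_b_def Let_def using econ_svd_gram(1) by blast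
qed

lemma run_b_updates:
  assumes d: "valid_data d" and b: "run_b d b" and k: "k \<in> {1..horizon d}"
  shows "time_update_a d (recomposed_run b) k" "meas_update_a d (recomposed_run b) k"
    "\<And>m. m \<le> substeps d \<Longrightarrow> svd_root (state_dim d) (Q_sub b k m) (H_sub b k m)"
    "svd_root (state_dim d) (Q_pred b k) (H_pred b k)"
    "svd_root (meas_dim d) (Q_Re b k) (H_Re b k)"
proof -
  have tb: "time_update_b d b k" and mb: "meas_update_b d b k"
    using b k by (auto simp: run_b_def)
  have filt: "svd_root (state_dim d) (Q_filt b (k - 1)) (H_filt b (k - 1))"
    using k by (intro run_b_svd_root[OF b]) auto
  note pred = time_update_b_pred[OF d tb filt]
  show "time_update_a d (recomposed_run b) k" by (rule time_update_b_imp_a[OF d tb filt])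
  show "\<And>m. m \<le> substeps d \<Longrightarrow> svd_root (state_dim d) (Q_sub b k m) (H_sub b k m)"
    by (rule time_update_b_svd_root[OF tb filt])
  show "svd_root (state_dim d) (Q_pred b k) (H_pred b k)" by (rule pred(1))
  show "meas_update_a d (recomposed_run b) k" "svd_root (meas_dim d) (Q_Re b k) (H_Re b k)"
    using meas_update_b_imp_a[OF d mb k pred] by auto
qed

lemma recomposed_run_is_run:
  assumes d: "valid_data d" and b: "run_b d b"
  shows "run_a d (recomposed_run b)" "svd_choices_from d (recomposed_run b) b"
proof -
  obtain D where "sym_svd (state_dim d) (init_cov d) (Q_filt b 0) D" "H_filt b 0 = diag_sqrt D"
    using b by (auto simp: run_b_def)
  then have "P_filt (recomposed_run b) 0 = init_cov d"
    using sym_svd_imp_svd_root(2) by (simp add: recomposed_run_def D_filt_def)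
  moreover have "x_filt (recomposed_run b) 0 = init_mean d"
    using b by (simp add: recomposed_run_def run_b_def)
  ultimately show "run_a d (recomposed_run b)"
    using run_b_updates(1,2)[OF d b] by (simp add: run_a_def)
  show "svd_choices_from d (recomposed_run b) b"
    by (simp add: svd_choices_from_def recomposed_run_def)
qed

lemma recomposed_run_factored_by:
  assumes d: "valid_data d" and b: "run_b d b" and k: "k \<in> {1..horizon d}" and m: "m \<le> substeps d"
  shows "factored_by (state_dim d) (P_sub (recomposed_run b) k m) (Q_sub b k m) (D_sub b k m)"
    "factored_by (state_dim d) (P_pred (recomposed_run b) k) (Q_pred b k) (D_pred b k)"
    "factored_by (meas_dim d) (R_e (recomposed_run b) k) (Q_Re b k) (D_Re b k)"
    "factored_by (state_dim d) (P_filt (recomposed_run b) k) (Q_filt b k) (D_filt b k)"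
  using svd_root_sym_svd[OF run_b_updates(3)[OF d b k m]]
    svd_root_sym_svd[OF run_b_updates(4)[OF d b k]]
    svd_root_sym_svd[OF run_b_updates(5)[OF d b k]]
    svd_root_sym_svd[OF run_b_svd_root[OF b, of k]] k
  by (simp_all add: sym_svd_def recomposed_run_def D_sub_def D_pred_def D_Re_def D_filt_def)

section \<open>Uniqueness of the run for prescribed SVD factors\<close>

lemma time_update_a_deterministic:
  assumes a: "time_update_a d a k" and a': "time_update_a d a' k"
    and svd: "\<And>m. m < substeps d \<Longrightarrow>
      svdQ_sub a k m = svdQ_sub a' k m \<and> svdD_sub a k m = svdD_sub a' k m"
    and filt: "x_filt a (k - 1) = x_filt a' (k - 1)" "P_filt a (k - 1) = P_filt a' (k - 1)"
    and m: "m \<le> substeps d"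
  shows "x_sub a k m = x_sub a' k m \<and> P_sub a k m = P_sub a' k m"
  using m
proof (induction m)
  case 0
  then show ?case using a a' filt by (simp add: time_update_a_def Let_def)
next
  case (Suc m)
  then have "m < substeps d" and IH: "x_sub a k m = x_sub a' k m" by auto
  then show ?case using a a' svd[of m] unfolding time_update_a_def Let_def by simp
qed

lemma meas_update_a_deterministic:
  assumes a: "meas_update_a d a k" and a': "meas_update_a d a' k"
    and svd: "svdQ_pred a k = svdQ_pred a' k" "svdD_pred a k = svdD_pred a' k"
    and pred: "x_pred a k = x_pred a' k" "P_pred a k = P_pred a' k"
  shows "z_pred a k = z_pred a' k" "R_e a k = R_e a' k" "P_xz a k = P_xz a' k"
    "gain a k = gain a' k" "x_filt a k = x_filt a' k" "P_filt a k = P_filt a' k"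
  using assms by (simp_all add: meas_update_a_def Let_def)

text \<open>
  The state of the recursion between two time steps is the filtered estimate with its
  covariance; the inner induction over the substeps is \<open>time_update_a_deterministic\<close>.
\<close>

lemma run_a_deterministic:
  assumes a: "run_a d a" and a': "run_a d a'"
    and svd: "svd_choices_from d a b" "svd_choices_from d a' b"
    and k: "k \<in> {1..horizon d}"
  shows "\<And>m. m \<le> substeps d \<Longrightarrow> x_sub a k m = x_sub a' k m \<and> P_sub a k m = P_sub a' k m"
    "x_pred a k = x_pred a' k" "P_pred a k = P_pred a' k"
    "z_pred a k = z_pred a' k" "R_e a k = R_e a' k" "P_xz a k = P_xz a' k"
    "gain a k = gain a' k" "x_filt a k = x_filt a' k" "P_filt a k = P_filt a' k"
proof -
  have step: "(\<forall>m\<le>substeps d. x_sub a k m = x_sub a' k m \<and> P_sub a k m = P_sub a' k m) \<and>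
      x_pred a k = x_pred a' k \<and> P_pred a k = P_pred a' k \<and>
      z_pred a k = z_pred a' k \<and> R_e a k = R_e a' k \<and> P_xz a k = P_xz a' k \<and>
      gain a k = gain a' k \<and> x_filt a k = x_filt a' k \<and> P_filt a k = P_filt a' k"
    if k: "k \<in> {1..horizon d}"
      and filt: "x_filt a (k - 1) = x_filt a' (k - 1)" "P_filt a (k - 1) = P_filt a' (k - 1)" for k
  proof -
    have u: "time_update_a d a k" "time_update_a d a' k" "meas_update_a d a k" "meas_update_a d a' k"
      using a a' k by (auto simp: run_a_def)
    have sub: "x_sub a k m = x_sub a' k m \<and> P_sub a k m = P_sub a' k m" if "m \<le> substeps d" for m
      using svd k that
      by (intro time_update_a_deterministic[OF u(1,2) _ filt]) (auto simp: svd_choices_from_def)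
    have pred: "x_pred a k = x_pred a' k" "P_pred a k = P_pred a' k"
      using u(1,2) sub[of "substeps d"] by (simp_all add: time_update_a_def Let_def)
    have "svdQ_pred a k = svdQ_pred a' k" "svdD_pred a k = svdD_pred a' k"
      using svd k by (simp_all add: svd_choices_from_def)
    from meas_update_a_deterministic[OF u(3,4) this pred] show ?thesis
      using sub pred by blast
  qed
  have filt: "x_filt a j = x_filt a' j \<and> P_filt a j = P_filt a' j" if "j \<le> horizon d" for j
    using that
  proof (induction j)
    case 0
    then show ?case using a a' by (simp add: run_a_def)
  next
    case (Suc j)
    then show ?case using step[of "Suc j"] by simp
  qed
  have "x_filt a (k - 1) = x_filt a' (k - 1)" "P_filt a (k - 1) = P_filt a' (k - 1)"
    using filt[of "k - 1"] k by auto
  from step[OF k this]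
  show "\<And>m. m \<le> substeps d \<Longrightarrow> x_sub a k m = x_sub a' k m \<and> P_sub a k m = P_sub a' k m"
    "x_pred a k = x_pred a' k" "P_pred a k = P_pred a' k"
    "z_pred a k = z_pred a' k" "R_e a k = R_e a' k" "P_xz a k = P_xz a' k"
    "gain a k = gain a' k" "x_filt a k = x_filt a' k" "P_filt a k = P_filt a' k"
    by auto
qed

theorem proposition1:
  fixes d :: ckf_data and b :: ckf_run_b
  assumes "valid_data d" and "run_b d b"
  shows "(\<exists>a. run_a d a \<and> svd_choices_from d a b) \<and>
    (\<forall>a. run_a d a \<and> svd_choices_from d a b \<longrightarrow>
      (\<forall>k\<in>{1..horizon d}. \<forall>m\<in>{0..substeps d}.
        x_sub a k m = x_sub b k m \<and>
        x_pred a k = x_pred b k \<and>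
        z_pred a k = z_pred b k \<and>
        x_filt a k = x_filt b k \<and>
        P_xz a k = P_xz b k \<and>
        gain a k = gain b k \<and>
        factored_by (state_dim d) (P_sub a k m) (Q_sub b k m) (D_sub b k m) \<and>
        factored_by (state_dim d) (P_pred a k) (Q_pred b k) (D_pred b k) \<and>
        factored_by (meas_dim d) (R_e a k) (Q_Re b k) (D_Re b k) \<and>
        factored_by (state_dim d) (P_filt a k) (Q_filt b k) (D_filt b k)))"
proof (intro conjI[of "\<exists>a. _ a"] allI impI ballI)
  note recomposed = recomposed_run_is_run[OF assms]
  then show "\<exists>a. run_a d a \<and> svd_choices_from d a b" by blast
  fix a k m
  assume a: "run_a d a \<and> svd_choices_from d a b"
    and k: "k \<in> {1..horizon d}" and m: "m \<in> {0..substeps d}"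
  have m': "m \<le> substeps d" using m by simp
  have same: "x_sub a k m = x_sub (recomposed_run b) k m" "P_sub a k m = P_sub (recomposed_run b) k m"
    "x_pred a k = x_pred (recomposed_run b) k" "P_pred a k = P_pred (recomposed_run b) k"
    "z_pred a k = z_pred (recomposed_run b) k" "R_e a k = R_e (recomposed_run b) k"
    "P_xz a k = P_xz (recomposed_run b) k" "gain a k = gain (recomposed_run b) k"
    "x_filt a k = x_filt (recomposed_run b) k" "P_filt a k = P_filt (recomposed_run b) k"
    using run_a_deterministic[of d a "recomposed_run b" b k] a recomposed k m' by auto
  have "x_sub (recomposed_run b) = x_sub b" "x_pred (recomposed_run b) = x_pred b"
    "z_pred (recomposed_run b) = z_pred b" "x_filt (recomposed_run b) = x_filt b"
    "P_xz (recomposed_run b) = P_xz b" "gain (recomposed_run b) = gain b"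
    by (simp_all add: recomposed_run_def)
  then show "x_sub a k m = x_sub b k m \<and>
        x_pred a k = x_pred b k \<and>
        z_pred a k = z_pred b k \<and>
        x_filt a k = x_filt b k \<and>
        P_xz a k = P_xz b k \<and>
        gain a k = gain b k \<and>
        factored_by (state_dim d) (P_sub a k m) (Q_sub b k m) (D_sub b k m) \<and>
        factored_by (state_dim d) (P_pred a k) (Q_pred b k) (D_pred b k) \<and>
        factored_by (meas_dim d) (R_e a k) (Q_Re b k) (D_Re b k) \<and>
        factored_by (state_dim d) (P_filt a k) (Q_filt b k) (D_filt b k)"
    unfolding same using recomposed_run_factored_by[OF assms k m'] by simp
qed

end
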